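(* Let $n\ge 2$ be an integer and let $f\in\Phi_n$. If $f\not\equiv \mathrm{const}$ on $[0,+\infty)$, then the function $x\mapsto f(|x|)$ is strictly positive definite on $\mathbb{R}^n$.
   Context: $|\cdot|$ is the Euclidean norm on $\mathbb{R}^n$. A function $g:\mathbb{R}^n\to\mathbb{C}$ is positive definite on $\mathbb{R}^n$ (written $g\in\Phi(\mathbb{R}^n)$) if it is continuous at $0$ and for all $m\in\mathbb{N}$, all finite sets of points $\{x_k\}_{k=1}^m\subset\mathbb{R}^n$ and all $\{\xi_k\}_{k=1}^m\subset\mathbb{C}$ one has $\sum_{k,j=1}^m \xi_k\overline{\xi}_j\, g(x_k-x_j)\ge 0$. It is strictly positive definite on $\mathbb{R}^n$ if, moreover, this inequality is strict whenever the points $x_1,\dots,x_m$ are distinct and $\sum_{k=1}^m|\xi_k|>0$. $C[0,\infty)$ denotes the space of bounded continuous functions on $[0,\infty)$. The class $\Phi_n$ of radial positive definite functions consists of all $f\in C[0,+\infty)$ such that $x\mapsto f(|x|)$ belongs to $\Phi(\mathbb{R}^n)$. *)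

theory Defs
  imports "HOL-Analysis.Analysis" "HOL-Library.Complex_Order"
begin

(* On complex numbers, the order of Complex_Order makes  0 \<le> z  (resp.  0 < z)  say that z is
   real and nonnegative (resp. positive).  The points x 1, ..., x m need not be distinct. *)
definition positive_definite :: "(real ^ 'n \<Rightarrow> complex) \<Rightarrow> bool" where
  "positive_definite g \<longleftrightarrow>
     isCont g 0 \<and>
     (\<forall>(m::nat) (x :: nat \<Rightarrow> real ^ 'n) (\<xi> :: nat \<Rightarrow> complex).
        0 \<le> (\<Sum>k = 1..m. \<Sum>j = 1..m. \<xi> k * cnj (\<xi> j) * g (x k - x j)))"

definition strictly_positive_definite :: "(real ^ 'n \<Rightarrow> complex) \<Rightarrow> bool" where
  "strictly_positive_definite g \<longleftrightarrow>
     positive_definite g \<and>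
     (\<forall>(m::nat) (x :: nat \<Rightarrow> real ^ 'n) (\<xi> :: nat \<Rightarrow> complex).
        inj_on x {1..m} \<longrightarrow> (\<Sum>k = 1..m. cmod (\<xi> k)) > 0 \<longrightarrow>
        0 < (\<Sum>k = 1..m. \<Sum>j = 1..m. \<xi> k * cnj (\<xi> j) * g (x k - x j)))"

(* The class \<Phi>_n with n = CARD('n).  Values of f at negative arguments are irrelevant. *)
definition radial_positive_definite :: "'n::finite itself \<Rightarrow> (real \<Rightarrow> complex) set" where
  "radial_positive_definite _ =
     {f. continuous_on {0..} f \<and> bounded (f ` {0..}) \<and>
         positive_definite (\<lambda>x :: real ^ 'n. f (norm x))}"

end

theory Submission
  imports Defs "HOL-Library.Poly_Mapping" "HOL-Complex_Analysis.Conformal_Mappings"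
    "HOL-Real_Asymp.Real_Asymp"
begin

text \<open>
  A positive definite function \<open>g\<close> acts on trigonometric polynomials by sending \<open>e\<^sub>y : u \<mapsto> exp (i y \<bullet> u)\<close>
  to \<open>g y\<close>. This functional is nonnegative on squares, and a spectral radius argument shows that it is
  nonnegative on every pointwise nonnegative trigonometric polynomial; this replaces Bochner's theorem.

  If the quadratic form of \<open>g = f \<circ> norm\<close> vanishes for points \<open>x\<^sub>k\<close> and weights \<open>\<xi>\<^sub>k\<close>, it also vanishes for all
  rotated point sets. As \<open>n \<ge> 2\<close>, the exponential sum \<open>\<Sum>k. \<xi>\<^sub>k exp (i x\<^sub>k \<bullet> u)\<close> is not identically zero on any
  sphere of positive radius, so by compactness finitely many rotated copies have no common zero with
  \<open>\<delta> \<le> |u| \<le> K\<close>. There \<open>1 - cos (x \<bullet> u)\<close> is bounded by a multiple of the sum of their squared moduli. For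
  \<open>|u| \<le> \<delta>\<close> it is at most \<open>\<delta>\<^sup>2 |x|\<^sup>2 / 2\<close>, and for \<open>|u| \<ge> K\<close> it is controlled by averages of
  \<open>1 - cos (t u\<^sub>l)\<close> over small \<open>t\<close>, on which the functional is small by continuity of \<open>f\<close> at \<open>0\<close>.
  Applying the functional to this inequality gives \<open>f 0 \<le> f |x|\<close>, so \<open>f\<close> is constant.
\<close>

section \<open>Positive definite functions as functionals on trigonometric polynomials\<close>

text \<open>\<open>P\<close> encodes the trigonometric polynomial whose coefficient at frequency \<open>y\<close> is
  \<open>Poly_Mapping.lookup P y\<close>; \<open>lin_ext h\<close> replaces the exponential of frequency \<open>y\<close> by \<open>h y\<close>.\<close>
definition lin_ext :: "('a \<Rightarrow> complex) \<Rightarrow> ('a \<Rightarrow>\<^sub>0 complex) \<Rightarrow> complex" where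
  "lin_ext h P = (\<Sum>y\<in>Poly_Mapping.keys P. Poly_Mapping.lookup P y * h y)"

lemma lin_ext_superset:
  assumes "finite S" "Poly_Mapping.keys P \<subseteq> S"
  shows "lin_ext h P = (\<Sum>y\<in>S. Poly_Mapping.lookup P y * h y)"
  unfolding lin_ext_def
  by (rule sum.mono_neutral_left) (use assms in \<open>auto simp: in_keys_iff\<close>)

lemma lin_ext_add: "lin_ext h (P + Q) = lin_ext h P + lin_ext h Q"
proof -
  let ?S = "Poly_Mapping.keys P \<union> Poly_Mapping.keys Q"
  have "finite ?S" by simp
  then have "lin_ext h R = (\<Sum>y\<in>?S. Poly_Mapping.lookup R y * h y)"
    if "R \<in> {P, Q, P + Q}" for R
    using that Poly_Mapping.keys_add[of P Q] by (intro lin_ext_superset) auto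
  then show ?thesis
    by (simp add: lookup_add distrib_right sum.distrib)
qed

lemma lin_ext_zero [simp]: "lin_ext h 0 = 0"
  by (simp add: lin_ext_def)

lemma lin_ext_diff: "lin_ext h (P - Q) = lin_ext h P - lin_ext h Q"
  using lin_ext_add[of h "P - Q" Q] by simp

lemma lin_ext_sum: "lin_ext h (\<Sum>i\<in>I. P i) = (\<Sum>i\<in>I. lin_ext h (P i))"
  by (induction I rule: infinite_finite_induct) (auto simp: lin_ext_add)

lemma lin_ext_single [simp]: "lin_ext h (Poly_Mapping.single y c) = c * h y"
  by (simp add: lin_ext_def)

lemma lin_ext_one [simp]: "lin_ext h 1 = h 0"
  using lin_ext_single[of h 0 1] by simp

lemma poly_mapping_eq_sum_single:
  "P = (\<Sum>y\<in>Poly_Mapping.keys P. Poly_Mapping.single y (Poly_Mapping.lookup P y))"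
  by (rule poly_mapping_eqI)
     (auto simp: lookup_sum lookup_single when_def in_keys_iff)

lemma lin_ext_mult:
  "lin_ext h (P * Q) = (\<Sum>y\<in>Poly_Mapping.keys P. \<Sum>z\<in>Poly_Mapping.keys Q.
     Poly_Mapping.lookup P y * Poly_Mapping.lookup Q z * h (y + z))"
proof -
  have "P * Q = (\<Sum>y\<in>Poly_Mapping.keys P. \<Sum>z\<in>Poly_Mapping.keys Q.
      Poly_Mapping.single (y + z) (Poly_Mapping.lookup P y * Poly_Mapping.lookup Q z))"
    by (subst poly_mapping_eq_sum_single[of P], subst poly_mapping_eq_sum_single[of Q])
       (simp add: sum_product mult_single)
  then show ?thesis
    by (simp add: lin_ext_sum)
qed

text \<open>Makes the coefficients of products and mean values accessible to the rules for
  \<open>lin_ext\<close>.\<close>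

lemma lookup_eq_lin_ext:
  "Poly_Mapping.lookup P w = lin_ext (\<lambda>y. of_bool (y = w)) P"
  by (auto simp: lin_ext_def in_keys_iff of_bool_def if_distrib cong: if_cong)

text \<open>The coefficient symmetry that makes the associated trigonometric polynomial
  real-valued.\<close>

definition self_adjoint :: "('a::uminus \<Rightarrow>\<^sub>0 complex) \<Rightarrow> bool" where
  "self_adjoint P \<longleftrightarrow> (\<forall>y. Poly_Mapping.lookup P (- y) = cnj (Poly_Mapping.lookup P y))"

lemma self_adjoint_add: "self_adjoint P \<Longrightarrow> self_adjoint Q \<Longrightarrow> self_adjoint (P + Q)"
  by (simp add: self_adjoint_def lookup_add)

lemma self_adjoint_diff: "self_adjoint P \<Longrightarrow> self_adjoint Q \<Longrightarrow> self_adjoint (P - Q)"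
  by (simp add: self_adjoint_def lookup_minus)

lemma self_adjoint_sum: "(\<And>i. i \<in> I \<Longrightarrow> self_adjoint (P i)) \<Longrightarrow> self_adjoint (\<Sum>i\<in>I. P i)"
  by (simp add: self_adjoint_def lookup_sum)

lemma self_adjoint_real [simp]:
  "self_adjoint (Poly_Mapping.single (0::'a::group_add) (complex_of_real c))"
  by (simp add: self_adjoint_def lookup_single when_def)

lemma self_adjoint_one [simp]: "self_adjoint (1 :: 'a::group_add \<Rightarrow>\<^sub>0 complex)"
  using self_adjoint_real[of 1] by simp

lemma sum_keys_uminus:
  fixes P :: "'a::group_add \<Rightarrow>\<^sub>0 complex"
  assumes "self_adjoint P"
  shows "(\<Sum>y\<in>Poly_Mapping.keys P. F y) = (\<Sum>y\<in>Poly_Mapping.keys P. F (- y))"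
  by (rule sum.reindex_bij_witness[of _ uminus uminus])
     (use assms in \<open>auto simp: in_keys_iff self_adjoint_def\<close>)

lemma self_adjoint_mult:
  fixes P Q :: "'a::ab_group_add \<Rightarrow>\<^sub>0 complex"
  assumes "self_adjoint P" "self_adjoint Q"
  shows "self_adjoint (P * Q)"
  unfolding self_adjoint_def
proof
  fix w
  have eq: "- y - z = - w \<longleftrightarrow> y + z = w" for y z :: 'a
    by (metis add_uminus_conv_diff minus_add_distrib neg_equal_iff_equal)
  have lookup: "Poly_Mapping.lookup (P * Q) x = (\<Sum>y\<in>Poly_Mapping.keys P. \<Sum>z\<in>Poly_Mapping.keys Q.
      Poly_Mapping.lookup P y * Poly_Mapping.lookup Q z * of_bool (y + z = x))" for x
    by (subst lookup_eq_lin_ext) (rule lin_ext_mult)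
  show "Poly_Mapping.lookup (P * Q) (- w) = cnj (Poly_Mapping.lookup (P * Q) w)"
    unfolding lookup
    by (subst sum_keys_uminus[OF assms(1)], subst sum_keys_uminus[OF assms(2)])
       (use assms in \<open>simp add: self_adjoint_def eq\<close>)
qed

lemma self_adjoint_power:
  fixes P :: "'a::ab_group_add \<Rightarrow>\<^sub>0 complex"
  shows "self_adjoint P \<Longrightarrow> self_adjoint (P ^ m)"
  by (induction m) (auto intro: self_adjoint_mult)

section \<open>Values of trigonometric polynomials and recovery of their coefficients\<close>

definition trig :: "'a::real_inner \<Rightarrow> ('a \<Rightarrow>\<^sub>0 complex) \<Rightarrow> complex" where
  "trig v = lin_ext (\<lambda>y. cis (y \<bullet> v))"

lemma trig_mult: "trig v (P * Q) = trig v P * trig v Q"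
  unfolding trig_def lin_ext_mult
  by (simp add: lin_ext_def sum_product inner_add_left cis_mult[symmetric] mult_ac)

lemma trig_power: "trig v (P ^ m) = trig v P ^ m"
  by (induction m) (simp_all add: trig_mult, simp add: trig_def)

lemma cnj_trig:
  assumes "self_adjoint P"
  shows "cnj (trig v P) = trig v P"
  unfolding trig_def lin_ext_def
  by (subst (2) sum_keys_uminus[OF assms]) (use assms in \<open>simp add: self_adjoint_def cis_cnj\<close>)

lemma norm_sum_power_le:
  fixes z :: complex
  assumes "norm z = 1" "z \<noteq> 1"
  shows "norm (\<Sum>k<N. z ^ k) \<le> 2 / norm (1 - z)"
proof -
  have "norm (\<Sum>k<N. z ^ k) = norm (1 - z ^ N) / norm (1 - z)"
    using assms by (simp add: sum_gp_strict norm_divide)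
  also have "norm (1 - z ^ N) \<le> 2"
    using norm_triangle_ineq4[of 1 "z ^ N"] assms by (simp add: norm_power)
  finally show ?thesis
    by (simp add: divide_right_mono)
qed

lemma mean_power_tendsto_0:
  fixes z :: complex
  assumes "norm z = 1" "z \<noteq> 1"
  shows "(\<lambda>N. (\<Sum>k<N. z ^ k) / of_nat N) \<longlonglongrightarrow> 0"
proof (rule Lim_null_comparison)
  show "\<forall>\<^sub>F N in sequentially. norm ((\<Sum>k<N. z ^ k) / of_nat N) \<le> (2 / norm (1 - z)) / real N"
    using norm_sum_power_le[OF assms]
    by (intro always_eventually allI) (simp add: norm_divide divide_right_mono del: divide_divide_eq_left)
  show "(\<lambda>N. (2 / norm (1 - z)) / real N) \<longlonglongrightarrow> 0"
    by (rule lim_const_over_n)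
qed

text \<open>Finitely many hyperplanes do not fill the space, so some \<open>v\<close> has nonzero
  inner product with every point of \<open>S\<close>. Scaling \<open>v\<close> down brings these
  products into (-1, 1), which contains no nonzero multiple of 2 pi.\<close>

lemma ex_vector_cis_neq_1:
  fixes S :: "'a::euclidean_space set"
  assumes "finite S" "0 \<notin> S"
  obtains v where "\<And>y. y \<in> S \<Longrightarrow> cis (y \<bullet> v) \<noteq> 1"
proof -
  have "negligible (\<Union>y\<in>S. {v. y \<bullet> v = 0})"
    using assms by (intro negligible_Union) (auto intro!: negligible_hyperplane)
  then have "(\<Union>y\<in>S. {v. y \<bullet> v = 0}) \<noteq> UNIV"
    by force
  then obtain v where v: "\<And>y. y \<in> S \<Longrightarrow> y \<bullet> v \<noteq> 0"
    by blast
  define B where "B = 1 + (\<Sum>y\<in>S. \<bar>y \<bullet> v\<bar>)"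
  have B: "\<bar>y \<bullet> v\<bar> < B" if "y \<in> S" for y
    using member_le_sum[OF that, of "\<lambda>y. \<bar>y \<bullet> v\<bar>"] assms by (simp add: B_def)
  have B0: "B > 0"
    by (simp add: B_def add_pos_nonneg sum_nonneg)
  have "cis (y \<bullet> (v /\<^sub>R B)) \<noteq> 1" if "y \<in> S" for y
  proof
    assume "cis (y \<bullet> (v /\<^sub>R B)) = 1"
    then have "cos (y \<bullet> v / B) = 1"
      by (simp add: complex_eq_iff divide_inverse mult.commute)
    then obtain k :: int where k: "y \<bullet> v / B = k * 2 * pi"
      by (auto simp: cos_one_2pi_int)
    have "k \<noteq> 0"
      using k v[OF that] B0 by auto
    then have "1 * 6 \<le> \<bar>real_of_int k\<bar> * (2 * pi)"
      using pi_gt3 by (intro mult_mono) auto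
    also have "\<dots> = \<bar>y \<bullet> v / B\<bar>"
      unfolding k by (simp add: abs_mult)
    also have "\<dots> < 1"
      using B[OF that] B0 by simp
    finally show False
      by simp
  qed
  then show ?thesis
    using that by blast
qed

text \<open>The coefficient at \<open>w\<close> is a mean value of the trigonometric polynomial times the conjugate
  exponential along a generic line.\<close>
lemma norm_lookup_le:
  fixes P :: "'a::euclidean_space \<Rightarrow>\<^sub>0 complex"
  assumes "\<And>v. norm (trig v P) \<le> B"
  shows "norm (Poly_Mapping.lookup P w) \<le> B"
proof -
  let ?K = "Poly_Mapping.keys P"
  obtain v where v: "\<And>x. x \<in> (\<lambda>y. y - w) ` (?K - {w}) \<Longrightarrow> cis (x \<bullet> v) \<noteq> 1"
    by (rule ex_vector_cis_neq_1[of "(\<lambda>y. y - w) ` (?K - {w})"]) auto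
  define M where "M N = (\<Sum>k<N. cis (- (w \<bullet> v)) ^ k * trig (real k *\<^sub>R v) P) / of_nat N" for N
  have M_eq: "M N = (\<Sum>y\<in>?K. Poly_Mapping.lookup P y * ((\<Sum>k<N. cis ((y - w) \<bullet> v) ^ k) / of_nat N))" for N
  proof -
    have "cis (- (w \<bullet> v)) ^ k * cis (y \<bullet> (real k *\<^sub>R v)) = cis ((y - w) \<bullet> v) ^ k" for k y
      by (simp only: Complex.DeMoivre cis_mult) (simp add: inner_diff_left algebra_simps)
    then have "(\<Sum>k<N. cis (- (w \<bullet> v)) ^ k * trig (real k *\<^sub>R v) P)
        = (\<Sum>k<N. \<Sum>y\<in>?K. Poly_Mapping.lookup P y * cis ((y - w) \<bullet> v) ^ k)"
      by (simp add: trig_def lin_ext_def sum_distrib_left mult.left_commute)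
    also have "\<dots> = (\<Sum>y\<in>?K. Poly_Mapping.lookup P y * (\<Sum>k<N. cis ((y - w) \<bullet> v) ^ k))"
      by (subst sum.swap) (simp add: sum_distrib_left)
    finally show ?thesis
      unfolding M_def by (simp only: sum_divide_distrib[where A = ?K] times_divide_eq_right)
  qed
  \<comment> \<open>The ratio of the geometric sum is 1 for \<open>y = w\<close>; otherwise it is a
    unimodular number different from 1 by the choice of \<open>v\<close>.\<close>
  have "(\<lambda>N. (\<Sum>k<N. cis ((y - w) \<bullet> v) ^ k) / of_nat N) \<longlonglongrightarrow> of_bool (y = w)" if "y \<in> ?K" for y
  proof (cases "y = w")
    case True
    have "\<forall>\<^sub>F N in sequentially. (1::complex) = of_nat N / of_nat N"
      using eventually_gt_at_top[of 0] by eventually_elim simp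
    then have "(\<lambda>N. of_nat N / of_nat N :: complex) \<longlonglongrightarrow> 1"
      by (rule Lim_transform_eventually[OF tendsto_const])
    then show ?thesis
      using True by simp
  next
    case False
    then show ?thesis
      using mean_power_tendsto_0[of "cis ((y - w) \<bullet> v)"] v[of "y - w"] that by simp
  qed
  then have "M \<longlonglongrightarrow> (\<Sum>y\<in>?K. Poly_Mapping.lookup P y * of_bool (y = w))"
    unfolding M_eq by (intro tendsto_sum tendsto_mult tendsto_const) auto
  then have lim: "M \<longlonglongrightarrow> Poly_Mapping.lookup P w"
    by (simp add: lookup_eq_lin_ext[of P w] lin_ext_def)
  have "norm (M N) \<le> B" if "N > 0" for N
  proof -
    have "norm (\<Sum>k<N. cis (- (w \<bullet> v)) ^ k * trig (real k *\<^sub>R v) P) \<le> (\<Sum>k<N. B)"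
      by (rule sum_norm_le) (simp add: norm_mult norm_power assms)
    then show ?thesis
      using that by (simp add: M_def norm_divide field_simps)
  qed
  then have "\<forall>\<^sub>F N in sequentially. norm (M N) \<le> B"
    by (rule eventually_mono[OF eventually_gt_at_top[of 0]])
  then show ?thesis
    by (rule tendsto_upperbound[OF tendsto_norm[OF lim]]) simp
qed

text \<open>A frequency of \<open>P ^ m\<close> is a sum of \<open>m\<close> frequencies of
  \<open>P\<close>, hence determined by their multiplicities, each at most \<open>m\<close>. This is
  the source of the polynomial count of frequencies.\<close>

lemma keys_power_subset:
  fixes P :: "'a::real_vector \<Rightarrow>\<^sub>0 complex"
  defines "D \<equiv> Poly_Mapping.keys P"
  shows "Poly_Mapping.keys (P ^ m) \<subseteq> (\<lambda>a. \<Sum>d\<in>D. real (a d) *\<^sub>R d) ` (D \<rightarrow>\<^sub>E {..m})"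
proof (induction m)
  case 0
  have "(\<lambda>d\<in>D. 0) \<in> D \<rightarrow>\<^sub>E {..0::nat}"
    by auto
  moreover have "(\<Sum>d\<in>D. real ((\<lambda>d\<in>D. 0::nat) d) *\<^sub>R d) = 0"
    by simp
  ultimately show ?case
    by (force simp: image_iff)
next
  case (Suc m)
  show ?case
  proof
    fix x assume "x \<in> Poly_Mapping.keys (P ^ Suc m)"
    then obtain d y where x: "x = d + y" "d \<in> D" "y \<in> Poly_Mapping.keys (P ^ m)"
      using keys_mult[of P "P ^ m"] by (auto simp: D_def)
    then obtain a where a: "a \<in> D \<rightarrow>\<^sub>E {..m}" "y = (\<Sum>d\<in>D. real (a d) *\<^sub>R d)"
      using Suc.IH by blast
    let ?b = "a(d := Suc (a d))"
    have "?b \<in> D \<rightarrow>\<^sub>E {..Suc m}"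
      using a x(2) by (auto simp: PiE_iff extensional_def le_SucI)
    moreover have "x = (\<Sum>d\<in>D. real (?b d) *\<^sub>R d)"
    proof -
      have "finite D" by (simp add: D_def)
      then show ?thesis
        using x(1,2) a(2) by (simp add: sum.remove[of D d] algebra_simps)
    qed
    ultimately show "x \<in> (\<lambda>a. \<Sum>d\<in>D. real (a d) *\<^sub>R d) ` (D \<rightarrow>\<^sub>E {..Suc m})"
      by blast
  qed
qed

lemma card_keys_power_le:
  fixes P :: "'a::real_vector \<Rightarrow>\<^sub>0 complex"
  shows "card (Poly_Mapping.keys (P ^ m)) \<le> Suc m ^ card (Poly_Mapping.keys P)"
proof -
  let ?D = "Poly_Mapping.keys P"
  have "card (Poly_Mapping.keys (P ^ m)) \<le> card ((\<lambda>a. \<Sum>d\<in>?D. real (a d) *\<^sub>R d) ` (?D \<rightarrow>\<^sub>E {..m}))"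
    by (intro card_mono keys_power_subset finite_imageI finite_PiE) auto
  also have "\<dots> \<le> card (?D \<rightarrow>\<^sub>E {..m})"
    by (intro card_image_le finite_PiE) auto
  also have "\<dots> = Suc m ^ card ?D"
    by (simp add: card_PiE)
  finally show ?thesis .
qed

section \<open>Positivity of the functional on squares and on nonnegative trigonometric
  polynomials\<close>

definition pd_kernel :: "('a::ab_group_add \<Rightarrow> complex) \<Rightarrow> bool" where
  "pd_kernel g \<longleftrightarrow> (\<forall>S c. finite S \<longrightarrow>
     0 \<le> Re (\<Sum>y\<in>S. \<Sum>z\<in>S. c y * cnj (c z) * g (y - z)))"

text \<open>Self-adjointness allows negating the second summation index, which turns the convolution
  into the quadratic form of \<open>g\<close>.\<close>

lemma pd_kernel_square:
  assumes "pd_kernel g" "self_adjoint P"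
  shows "0 \<le> Re (lin_ext g (P * P))"
proof -
  let ?c = "Poly_Mapping.lookup P"
  have "lin_ext g (P * P) = (\<Sum>y\<in>Poly_Mapping.keys P. \<Sum>z\<in>Poly_Mapping.keys P. ?c y * cnj (?c z) * g (y - z))"
    unfolding lin_ext_mult
    by (subst (2) sum_keys_uminus[OF assms(2)]) (use assms(2) in \<open>simp add: self_adjoint_def\<close>)
  then show ?thesis
    using assms(1) by (simp add: pd_kernel_def)
qed

text \<open>The functional is nonnegative on the square of \<open>s P - t\<close>, which gives a
  nonnegative quadratic form in \<open>s\<close> and \<open>t\<close>; the claim is its discriminant
  inequality.\<close>

lemma pd_kernel_Cauchy_Schwarz:
  assumes g: "pd_kernel g" and P: "self_adjoint P"
  shows "(Re (lin_ext g P))\<^sup>2 \<le> Re (g 0) * Re (lin_ext g (P * P))"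
proof -
  let ?a = "Re (lin_ext g P)" and ?b = "Re (lin_ext g (P * P))"
  have quad: "0 \<le> s\<^sup>2 * ?b - 2 * s * t * ?a + t\<^sup>2 * Re (g 0)" for s t :: real
  proof -
    let ?s = "Poly_Mapping.single 0 (complex_of_real s)"
    let ?t = "Poly_Mapping.single 0 (complex_of_real t)"
    have lin: "lin_ext g (Poly_Mapping.single 0 c * R) = c * lin_ext g R" for c R
      by (cases "c = 0") (simp_all add: lin_ext_mult, simp add: lin_ext_def sum_distrib_left mult.assoc)
    have "0 \<le> Re (lin_ext g ((?s * P - ?t) * (?s * P - ?t)))"
      using P by (intro pd_kernel_square g self_adjoint_diff self_adjoint_mult) auto
    also have "(?s * P - ?t) * (?s * P - ?t) =
        ?s * (?s * (P * P)) - ?s * (?t * P) - ?s * (?t * P) + ?t * ?t"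
      by (simp add: algebra_simps)
    also have "Re (lin_ext g \<dots>) = s\<^sup>2 * ?b - 2 * s * t * ?a + t\<^sup>2 * Re (g 0)"
      by (simp only: lin_ext_add lin_ext_diff lin lin_ext_single)
        (simp add: power2_eq_square algebra_simps)
    finally show ?thesis .
  qed
  have g0: "0 \<le> Re (g 0)" and b: "0 \<le> ?b"
    using quad[of 0 1] quad[of 1 0] by simp_all
  show ?thesis
  proof (cases "Re (g 0) = 0")
    case True
    have "?a = 0"
    proof (rule ccontr)
      assume "?a \<noteq> 0"
      then show False
        \<comment> \<open>This choice of \<open>t\<close> makes the quadratic form equal to
          -1.\<close>
        using quad[of 1 "(?b + 1) / (2 * ?a)"] True by (simp add: field_simps)
    qed
    then show ?thesis
      using True by simp
  next
    case False
    then have "0 < Re (g 0)" using g0 by simp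
    moreover have "0 \<le> Re (g 0) * (Re (g 0) * ?b - ?a\<^sup>2)"
      using quad[of "Re (g 0)" ?a] by (simp add: power2_eq_square algebra_simps)
    ultimately show ?thesis
      by (simp add: zero_le_mult_iff)
  qed
qed

text \<open>Cauchy-Schwarz makes the values on \<open>P ^ (2 ^ k)\<close> grow exponentially in \<open>2 ^ k\<close> if the claim fails,
  whereas \<open>P ^ m\<close> has coefficients bounded by \<open>1\<close> and only polynomially many frequencies.\<close>
lemma pd_kernel_le:
  fixes P :: "'a::euclidean_space \<Rightarrow>\<^sub>0 complex"
  assumes g: "pd_kernel g" and G: "\<And>y. norm (g y) \<le> G"
    and P: "self_adjoint P" and le: "\<And>v. norm (trig v P) \<le> 1"
  shows "Re (lin_ext g P) \<le> Re (g 0)"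
proof (rule ccontr)
  define a where "a m = Re (lin_ext g (P ^ m))" for m
  let ?d = "card (Poly_Mapping.keys P)"
  have sq: "(a m)\<^sup>2 \<le> Re (g 0) * a (2 * m)" for m
    using pd_kernel_Cauchy_Schwarz[OF g self_adjoint_power[OF P, of m]]
    by (simp add: a_def power_add[symmetric] mult_2)
  have G0: "G \<ge> 0"
    using G[of 0] norm_ge_zero[of "g 0"] by linarith
  have bound: "a m \<le> G * real (Suc m ^ ?d)" for m
  proof -
    let ?K = "Poly_Mapping.keys (P ^ m)"
    \<comment> \<open>The values of \<open>P ^ m\<close> are also bounded by 1, and the coefficients
      are mean values of them.\<close>
    have c: "norm (Poly_Mapping.lookup (P ^ m) y) \<le> 1" for y
      by (rule norm_lookup_le) (simp add: trig_power norm_power le power_le_one)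
    have "a m \<le> norm (lin_ext g (P ^ m))"
      by (simp add: a_def complex_Re_le_cmod)
    also have "\<dots> \<le> (\<Sum>y\<in>?K. 1 * G)"
      unfolding lin_ext_def by (rule sum_norm_le) (simp only: norm_mult, intro mult_mono c G, auto)
    also have "\<dots> = G * real (card ?K)"
      by simp
    also have "\<dots> \<le> G * real (Suc m ^ ?d)"
      using card_keys_power_le[of P m] G0 by (intro mult_left_mono of_nat_mono) auto
    finally show ?thesis .
  qed
  assume "\<not> Re (lin_ext g P) \<le> Re (g 0)"
  then have a1: "a 1 > Re (g 0)"
    by (simp add: a_def)
  have g0: "Re (g 0) \<ge> 0"
    using pd_kernel_square[OF g, of 1] by simp
  \<comment> \<open>If \<open>Re (g 0)\<close> were 0, Cauchy-Schwarz would force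
    \<open>a 1 = 0\<close>.\<close>
  then have pos: "Re (g 0) > 0"
    using sq[of 1] a1 by (cases "Re (g 0) = 0") auto
  define q where "q = a 1 / Re (g 0)"
  have q: "q > 1"
    using a1 pos by (simp add: q_def)
  \<comment> \<open>Each squaring of \<open>P\<close> squares the ratio of \<open>a\<close> to
    \<open>Re (g 0)\<close>, up to the inequality \<open>sq\<close>.\<close>
  have grow: "Re (g 0) * q ^ (2 ^ k) \<le> a (2 ^ k)" for k
  proof (induction k)
    case 0
    then show ?case
      using pos by (simp add: q_def)
  next
    case (Suc k)
    have "(Re (g 0) * q ^ (2 ^ k))\<^sup>2 \<le> (a (2 ^ k))\<^sup>2"
      using Suc pos q by (intro power_mono) auto
    also note sq[of "2 ^ k"]
    also have "(Re (g 0) * q ^ (2 ^ k))\<^sup>2 = Re (g 0) * (Re (g 0) * q ^ (2 ^ Suc k))"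
      by (simp add: power_mult_distrib power2_eq_square flip: power_mult)
        (simp add: mult_2 power_add)
    finally have "Re (g 0) * (Re (g 0) * q ^ (2 ^ Suc k)) \<le> Re (g 0) * a (2 ^ Suc k)"
      by simp
    then show ?case
      using pos by simp
  qed
  have "(\<lambda>m. G * real (Suc m ^ ?d) / q ^ m) \<longlonglongrightarrow> 0"
  proof -
    have "(\<lambda>m. G * (real (m + 1) ^ ?d / q ^ m)) \<longlonglongrightarrow> G * 0"
      using q by (intro tendsto_mult tendsto_const) real_asymp
    then show ?thesis
      by (simp add: add.commute)
  qed
  then have "(\<lambda>k. G * real (Suc (2 ^ k) ^ ?d) / q ^ (2 ^ k)) \<longlonglongrightarrow> 0"
    by (rule filterlim_compose[where g = "\<lambda>m. G * real (Suc m ^ ?d) / q ^ m"])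
       (rule filterlim_subseq, simp add: strict_mono_def)
  then have "\<forall>\<^sub>F k in sequentially. G * real (Suc (2 ^ k) ^ ?d) / q ^ (2 ^ k) < Re (g 0)"
    using pos by (rule order_tendstoD)
  then obtain k where "G * real (Suc (2 ^ k) ^ ?d) / q ^ (2 ^ k) < Re (g 0)"
    by (auto simp: eventually_sequentially)
  then have "G * real (Suc (2 ^ k) ^ ?d) < Re (g 0) * q ^ (2 ^ k)"
    using q by (simp add: pos_divide_less_eq)
  then show False
    using grow[of k] bound[of "2 ^ k"] by linarith
qed

text \<open>If \<open>M\<close> bounds the values of \<open>P\<close>, then
  \<open>Q = 1 - P / M\<close> takes values in [0, 1], and \<open>pd_kernel_le\<close> for
  \<open>Q\<close> rearranges to the claim. The summand 1 in \<open>M\<close> keeps it positive even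
  for \<open>P = 0\<close>.\<close>

theorem pd_kernel_nonneg:
  fixes P :: "'a::euclidean_space \<Rightarrow>\<^sub>0 complex"
  assumes g: "pd_kernel g" and G: "\<And>y. norm (g y) \<le> G"
    and P: "self_adjoint P" and nonneg: "\<And>v. 0 \<le> Re (trig v P)"
  shows "0 \<le> Re (lin_ext g P)"
proof -
  define M where "M = 1 + (\<Sum>y\<in>Poly_Mapping.keys P. norm (Poly_Mapping.lookup P y))"
  have M: "M > 0"
    by (simp add: M_def add_pos_nonneg sum_nonneg)
  define Q where "Q = 1 - Poly_Mapping.single 0 (complex_of_real (1 / M)) * P"
  have lin: "lin_ext h Q = h 0 - lin_ext h P / M" for h
    using M by (simp add: Q_def lin_ext_diff lin_ext_mult)
      (simp add: lin_ext_def sum_divide_distrib)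
  have "Re (lin_ext g Q) \<le> Re (g 0)"
  proof (rule pd_kernel_le[OF g G])
    show "self_adjoint Q"
      unfolding Q_def by (intro self_adjoint_diff self_adjoint_one self_adjoint_mult self_adjoint_real P)
    fix v
    have "norm (trig v P) \<le> M"
      unfolding trig_def lin_ext_def M_def
      by (rule order_trans[OF norm_sum]) (simp add: norm_mult)
    then have "Re (trig v P) \<le> M"
      using complex_Re_le_cmod order_trans by blast
    moreover have "trig v P = complex_of_real (Re (trig v P))"
      using cnj_trig[OF P, of v] by (metis complex_is_Real_iff Reals_cnj_iff of_real_Re)
    then have "trig v Q = complex_of_real (1 - Re (trig v P) / M)"
      by (simp add: trig_def lin)
    then have "norm (trig v Q) = \<bar>1 - Re (trig v P) / M\<bar>"
      by (simp only: norm_of_real)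
    moreover have "0 \<le> Re (trig v P) / M" "Re (trig v P) / M \<le> 1"
      using nonneg[of v] M calculation(1) by simp_all
    ultimately show "norm (trig v Q) \<le> 1"
      by simp
  qed
  then show ?thesis
    using M by (simp add: lin zero_le_divide_iff)
qed

section \<open>Exponential sums on spheres\<close>

text \<open>On a great circle the sum is an entire function of the angle. On the imaginary axis its terms
  grow at different rates, and the farthest point from the origin dominates.\<close>
lemma exp_sum_nonzero_on_sphere:
  fixes x :: "'i \<Rightarrow> 'a::euclidean_space"
  assumes dim: "DIM('a) \<ge> 2" and I: "finite I" and inj: "inj_on x I"
    and c: "\<exists>i\<in>I. c i \<noteq> 0" and s: "s > 0"
  obtains w where "norm w = s" "(\<Sum>i\<in>I. c i * cis (x i \<bullet> w)) \<noteq> 0"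
proof -
  define J where "J = {i \<in> I. c i \<noteq> 0}"
  have J: "finite J" "J \<noteq> {}"
    using I c by (auto simp: J_def)
  obtain k where k: "k \<in> J" and max: "\<And>i. i \<in> J \<Longrightarrow> norm (x i) \<le> norm (x k)"
  proof -
    have "Max ((\<lambda>i. norm (x i)) ` J) \<in> (\<lambda>i. norm (x i)) ` J"
      using J by (intro Max_in) auto
    then obtain k where "k \<in> J" "norm (x k) = Max ((\<lambda>i. norm (x i)) ` J)"
      by auto
    then show ?thesis
      using J by (intro that[of k]) auto
  qed
  show ?thesis
  proof (cases "x k = 0")
    case True
    \<comment> \<open>If the farthest point is the origin, all points with nonzero weight coincide
      with it, so a single term remains.\<close>
    have "J = {k}"
    proof -
      have "i = k" if "i \<in> J" for i
        using max[OF that] True that k by (intro inj_onD[OF inj]) (auto simp: J_def)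
      then show ?thesis
        using k by blast
    qed
    obtain w :: 'a where w: "norm w = s"
      using vector_choose_size[of s] s by auto
    have "(\<Sum>i\<in>I. c i * cis (x i \<bullet> w)) = (\<Sum>i\<in>J. c i * cis (x i \<bullet> w))"
      by (rule sum.mono_neutral_right) (auto simp: J_def I)
    also have "\<dots> \<noteq> 0"
    proof -
      have "c k \<noteq> 0"
        using k by (simp add: J_def)
      then show ?thesis
        using True by (simp add: \<open>J = {k}\<close>)
    qed
    finally show ?thesis
      using w that by blast
  next
    case False
    define u where "u = x k /\<^sub>R norm (x k)"
    have u: "norm u = 1"
      using False by (simp add: u_def)
    obtain a0 where "a0 \<noteq> 0" "orthogonal u a0"
      using orthogonal_to_vector_exists[OF dim, of u] by blast
    then obtain a where a: "norm a = 1" "u \<bullet> a = 0"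
      by (intro that[of "a0 /\<^sub>R norm a0"]) (auto simp: orthogonal_def)
    \<comment> \<open>The gap between \<open>x k\<close> and \<open>x i\<close> in direction
      \<open>u\<close>. It is positive since \<open>x k\<close> has maximal norm and the points are
      distinct.\<close>
    define d where "d i = x k \<bullet> u - x i \<bullet> u" for i
    have d: "d i > 0" if "i \<in> J - {k}" for i
    proof -
      have "x i \<noteq> x k"
        using that k inj by (auto simp: J_def dest: inj_onD)
      then have "0 < (x i - x k) \<bullet> (x i - x k)"
        by simp
      also have "\<dots> = (norm (x i))\<^sup>2 + (norm (x k))\<^sup>2 - 2 * (x i \<bullet> x k)"
        by (simp add: inner_diff_left inner_diff_right power2_norm_eq_inner inner_commute)
      also have "\<dots> \<le> 2 * ((norm (x k))\<^sup>2 - x i \<bullet> x k)"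
        using max[of i] that by (simp add: power_mono)
      also have "\<dots> = 2 * norm (x k) * d i"
        using False by (simp add: d_def u_def power2_norm_eq_inner field_simps)
      finally show ?thesis
        using False by (simp add: zero_less_mult_iff)
    qed
    \<comment> \<open>The great circle through \<open>a\<close> and \<open>u\<close>; the sign of
      the sine makes the terms below grow like
      \<open>exp (s * t * (x i \<bullet> u))\<close>.\<close>
    have "\<exists>\<theta>. (\<Sum>i\<in>I. c i * cis (x i \<bullet> (s *\<^sub>R (cos \<theta> *\<^sub>R a - sin \<theta> *\<^sub>R u)))) \<noteq> 0"
    proof (rule ccontr)
      assume "\<not> ?thesis"
      then have zero: "(\<Sum>i\<in>I. c i * cis (x i \<bullet> (s *\<^sub>R (cos \<theta> *\<^sub>R a - sin \<theta> *\<^sub>R u)))) = 0" for \<theta>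
        by blast
      define F where "F z = (\<Sum>i\<in>I. c i * exp (\<i> * of_real s *
          (of_real (x i \<bullet> a) * cos z - of_real (x i \<bullet> u) * sin z)))" for z
      have F_real: "F z = 0" if "z \<in> \<real>" for z
      proof -
        obtain \<theta> where \<theta>: "z = of_real \<theta>"
          using \<open>z \<in> \<real>\<close> by (rule Reals_cases)
        show ?thesis
          using zero[of \<theta>]
          by (simp add: F_def \<theta> cis_conv_exp inner_diff_right algebra_simps
                   flip: cos_of_real sin_of_real)
      qed
      have hol: "F holomorphic_on UNIV"
        unfolding F_def by (intro holomorphic_intros)
      have lim: "(0::complex) islimpt \<real>"
        unfolding islimpt_approachable
      proof (intro allI impI)
        fix e :: real assume "e > 0"
        then show "\<exists>y\<in>\<real>. y \<noteq> 0 \<and> dist y (0::complex) < e"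
          by (intro bexI[of _ "of_real (e / 2)"]) auto
      qed
      have F0: "F z = 0" for z
        by (rule analytic_continuation[OF hol, of \<real> 0]) (use lim F_real in auto)
      have bound: "norm (c k) \<le> (\<Sum>i\<in>I - {k}. norm (c i) * exp (- (s * d i * t)))" for t
      proof -
        \<comment> \<open>At this imaginary angle \<open>cos z\<close> is real and
          \<open>sin z\<close> equals \<open>\<i> * t\<close>. So \<open>a\<close> affects only the
          phase of a term and \<open>u\<close> only its modulus; dividing by the modulus of the
          \<open>k\<close>-th exponential leaves the rates \<open>s * d i\<close>.\<close>
        define z where "z = \<i> * complex_of_real (arsinh t)"
        define G where "G i = exp (\<i> * of_real s *
          (of_real (x i \<bullet> a) * cos z - of_real (x i \<bullet> u) * sin z))" for i
        have "cos z = of_real (cosh (arsinh t))"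
          by (simp add: z_def cos_i_times cosh_field_def exp_minus flip: exp_of_real)
        moreover have "sin z = \<i> * of_real (sinh (arsinh t))"
          unfolding z_def sin_i_times sinh_field_def by (simp add: exp_minus flip: exp_of_real)
        ultimately have "cos z = of_real (cosh (arsinh t))" "sin z = \<i> * of_real t"
          by simp_all
        then have e: "norm (G i) = exp (s * t * (x i \<bullet> u))" for i
          by (simp add: G_def algebra_simps)
        have "c k * G k + (\<Sum>i\<in>I - {k}. c i * G i) = 0"
          using F0[of z] k I sum.remove[of I k "\<lambda>i. c i * G i"] by (simp add: F_def G_def J_def)
        then have "c k * G k = - (\<Sum>i\<in>I - {k}. c i * G i)"
          by (simp add: eq_neg_iff_add_eq_0)
        then have "norm (c k * G k) = norm (\<Sum>i\<in>I - {k}. c i * G i)"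
          by (simp only: norm_minus_cancel)
        also have "\<dots> \<le> (\<Sum>i\<in>I - {k}. norm (c i) * exp (s * t * (x i \<bullet> u)))"
          by (rule sum_norm_le) (simp only: norm_mult e order.refl)
        also have "\<dots> = (\<Sum>i\<in>I - {k}. norm (c i) * exp (- (s * d i * t))) * exp (s * t * (x k \<bullet> u))"
          unfolding sum_distrib_right mult.assoc[of "norm _"] exp_add[symmetric]
          by (simp add: d_def algebra_simps)
        finally show ?thesis
          by (simp add: norm_mult e)
      qed
      have "((\<lambda>t. \<Sum>i\<in>I - {k}. norm (c i) * exp (- (s * d i * t))) \<longlongrightarrow> (\<Sum>i\<in>I - {k}. 0)) at_top"
      proof (rule tendsto_sum)
        fix i assume i: "i \<in> I - {k}"
        show "((\<lambda>t. norm (c i) * exp (- (s * d i * t))) \<longlongrightarrow> 0) at_top"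
        proof (cases "c i = 0")
          case False
          then have "s * d i > 0"
            using i d s by (auto simp: J_def)
          moreover have "((\<lambda>t. norm (c i) * exp (- (e * t))) \<longlongrightarrow> 0) at_top" if "e > 0" for e :: real
            using that by real_asymp
          ultimately show ?thesis
            by blast
        qed auto
      qed
      then have "norm (c k) \<le> 0"
        using bound by (intro tendsto_lowerbound[of _ _ at_top "norm (c k)"]) auto
      then show False
        using k by (simp add: J_def)
    qed
    then obtain \<theta> where nz: "(\<Sum>i\<in>I. c i * cis (x i \<bullet> (s *\<^sub>R (cos \<theta> *\<^sub>R a - sin \<theta> *\<^sub>R u)))) \<noteq> 0"
      by blast
    have "(norm (cos \<theta> *\<^sub>R a - sin \<theta> *\<^sub>R u))\<^sup>2 = (cos \<theta>)\<^sup>2 * (norm a)\<^sup>2 + (sin \<theta>)\<^sup>2 * (norm u)\<^sup>2"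
      using a(2) unfolding power2_norm_eq_inner
      by (simp add: inner_diff_left inner_diff_right inner_commute power2_eq_square)
    then have "norm (cos \<theta> *\<^sub>R a - sin \<theta> *\<^sub>R u) = 1"
      using a(1) u by (simp add: power2_eq_1_iff) (smt (verit) norm_ge_zero)
    then show ?thesis
      using that[OF _ nz] s by simp
  qed
qed

text \<open>Orthogonal maps act transitively on spheres, so a point of the sphere through
  \<open>u\<close> where the sum is nonzero can be moved to \<open>u\<close>. Compactness of the
  shell leaves finitely many maps.\<close>

lemma finitely_many_rotations:
  fixes x :: "'i \<Rightarrow> real ^ 'n"
  assumes dim: "CARD('n) \<ge> 2" and I: "finite I" and inj: "inj_on x I"
    and c: "\<exists>i\<in>I. c i \<noteq> 0" and \<delta>: "\<delta> > 0"
  obtains F :: "(real ^ 'n \<Rightarrow> real ^ 'n) set" and \<kappa> :: real where "finite F" "\<And>T. T \<in> F \<Longrightarrow> orthogonal_transformation T" "\<kappa> > 0"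
    "\<And>u. \<delta> \<le> norm u \<Longrightarrow> norm u \<le> K \<Longrightarrow>
       \<exists>T\<in>F. \<kappa> \<le> norm (\<Sum>i\<in>I. c i * cis (T (x i) \<bullet> u))"
proof -
  let ?A = "cball 0 K - ball (0 :: real ^ 'n) \<delta>"
  \<comment> \<open>The index \<open>m\<close> records a quantitative lower bound, so that a finite
    subcover yields a uniform \<open>\<kappa>\<close>.\<close>
  define U where "U = (\<lambda>(T :: real ^ 'n \<Rightarrow> real ^ 'n, m::nat). {u. 1 / real (Suc m) < norm (\<Sum>i\<in>I. c i * cis (T (x i) \<bullet> u))})"
  let ?D = "{T :: real ^ 'n \<Rightarrow> real ^ 'n. orthogonal_transformation T} \<times> (UNIV :: nat set)"
  have cover: "?A \<subseteq> (\<Union>p\<in>?D. U p)"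
  proof
    fix u assume "u \<in> ?A"
    then have pos: "norm u > 0"
      using \<delta> by auto
    obtain w where w: "norm w = norm u" "(\<Sum>i\<in>I. c i * cis (x i \<bullet> w)) \<noteq> 0"
      using exp_sum_nonzero_on_sphere[OF _ I inj c pos] dim by auto
    obtain T where T: "orthogonal_transformation T" "T w = u"
      using orthogonal_transformation_exists[OF w(1)] by blast
    have "T (x i) \<bullet> u = x i \<bullet> w" for i
      using T by (auto simp: orthogonal_transformation_def)
    then have "norm (\<Sum>i\<in>I. c i * cis (T (x i) \<bullet> u)) > 0"
      using w(2) by simp
    then obtain m where "1 / real (Suc m) < norm (\<Sum>i\<in>I. c i * cis (T (x i) \<bullet> u))"
      using nat_approx_posE by blast
    then show "u \<in> (\<Union>p\<in>?D. U p)"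
      using T(1) by (intro UN_I[of "(T, m)"]) (auto simp: U_def)
  qed
  have "compact ?A"
    by (intro compact_diff compact_cball open_ball)
  moreover have "open (U p)" for p
    unfolding U_def by (cases p) (auto intro!: open_Collect_less continuous_intros)
  ultimately obtain D where D: "D \<subseteq> ?D" "finite D" "?A \<subseteq> (\<Union>p\<in>D. U p)"
    using cover by (rule compactE_image)
  \<comment> \<open>The inserted 1 keeps the minimum meaningful when the subcover is empty.\<close>
  define \<kappa> where "\<kappa> = Min (insert 1 ((\<lambda>p. 1 / real (Suc (snd p))) ` D))"
  show ?thesis
  proof (rule that[of "fst ` D" \<kappa>])
    show "\<kappa> > 0"
      unfolding \<kappa>_def using D(2) by (subst Min_gr_iff) auto
    fix u :: "real ^ 'n" assume "\<delta> \<le> norm u" "norm u \<le> K"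
    then obtain p where p: "p \<in> D" "u \<in> U p"
      using D(3) by fastforce
    have "\<kappa> \<le> 1 / real (Suc (snd p))"
      unfolding \<kappa>_def using D(2) p(1) by (intro Min_le) auto
    also have "\<dots> \<le> norm (\<Sum>i\<in>I. c i * cis (fst p (x i) \<bullet> u))"
      using p(2) by (auto simp: U_def case_prod_beta)
    finally show "\<exists>T\<in>fst ` D. \<kappa> \<le> norm (\<Sum>i\<in>I. c i * cis (T (x i) \<bullet> u))"
      using p(1) by blast
  qed (use D in auto)
qed

section \<open>Waves with frequencies in a lattice\<close>

lemma norm_1_minus_cis: "norm (1 - cis t) = 2 * \<bar>sin (t / 2)\<bar>"
proof -
  have "(norm (1 - cis t))\<^sup>2 = (1 - cos t)\<^sup>2 + (sin t)\<^sup>2"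
    by (simp add: cmod_power2)
  also have "\<dots> = 2 * (1 - cos t)"
    by (simp add: sin_squared_eq power2_eq_square algebra_simps)
  also have "\<dots> = (2 * \<bar>sin (t / 2)\<bar>)\<^sup>2"
    using cos_double_sin[of "t / 2"] by (simp add: power_mult_distrib)
  finally show ?thesis
    by (rule power2_eq_imp_eq) auto
qed

lemma norm_cis_diff_le: "norm (cis a - cis b) \<le> \<bar>a - b\<bar>"
proof -
  have "cis a - cis b = - (cis b * (1 - cis (a - b)))"
    by (simp add: algebra_simps cis_mult)
  then have "norm (cis a - cis b) = 2 * \<bar>sin ((a - b) / 2)\<bar>"
    by (simp add: norm_mult norm_1_minus_cis)
  also have "\<dots> \<le> \<bar>a - b\<bar>"
    using abs_sin_x_le_abs_x[of "(a - b) / 2"] by simp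
  finally show ?thesis .
qed

text \<open>With \<open>y = \<bar>t / 2\<bar>\<close>, which is at most 2, the cubic Taylor bound
  gives \<open>sin y \<ge> y - y ^ 3 / 6 \<ge> y / 3\<close>.\<close>

lemma norm_1_minus_cis_ge:
  assumes "\<bar>t\<bar> \<le> pi"
  shows "\<bar>t\<bar> / 3 \<le> norm (1 - cis t)"
proof -
  define y where "y = \<bar>t / 2\<bar>"
  have y: "0 \<le> y" "y \<le> 2"
    using assms pi_half_less_two by (auto simp: y_def)
  have "\<bar>sin y - y\<bar> \<le> y ^ 3 / 6"
    using Maclaurin_sin_bound[of y 3] y by (simp add: numeral_eq_Suc sin_coeff_def)
  moreover have "y ^ 3 \<le> 4 * y"
    using power_mono[OF y(2,1), of 2] y(1) by (simp add: power3_eq_cube power2_eq_square mult_right_mono)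
  ultimately have "y / 3 \<le> sin y"
    by linarith
  moreover have "\<bar>sin (t / 2)\<bar> = \<bar>sin y\<bar>"
    by (auto simp: y_def abs_if)
  ultimately show ?thesis
    by (simp add: norm_1_minus_cis y_def)
qed

text \<open>The geometric sum of cosines is at most 2 divided by the chord length, hence at most
  \<open>6 / \<bar>t\<bar>\<close>; the constant 12 makes this at most \<open>N / 2\<close>.\<close>

lemma mean_one_minus_cos_ge:
  assumes t: "\<bar>t\<bar> \<le> pi" and N: "12 \<le> real N * \<bar>t\<bar>"
  shows "1 / 2 \<le> (\<Sum>k<N. 1 - cos (real k * t)) / real N"
proof -
  have pos: "\<bar>t\<bar> > 0" "real N > 0"
    using N by (auto simp: zero_less_mult_iff intro!: gr0I)
  have n: "norm (1 - cis t) > 0"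
    using norm_1_minus_cis_ge[OF t] pos by linarith
  have "(\<Sum>k<N. cos (real k * t)) = Re (\<Sum>k<N. cis t ^ k)"
    by (simp only: Complex.DeMoivre Re_sum cis.sel)
  also have "\<dots> \<le> norm (\<Sum>k<N. cis t ^ k)"
    by (rule complex_Re_le_cmod)
  also have "\<dots> \<le> 2 / norm (1 - cis t)"
    by (rule norm_sum_power_le) (use n in auto)
  also have "\<dots> \<le> 2 / (\<bar>t\<bar> / 3)"
    using norm_1_minus_cis_ge[OF t] pos n by (intro divide_left_mono) auto
  also have "\<dots> \<le> real N / 2"
    using N pos by (simp add: field_simps)
  finally show ?thesis
    using pos by (simp add: sum_subtractf field_simps)
qed

text \<open>A finite average of \<open>1 - cos\<close> returns close to \<open>0\<close> at arbitrarily large arguments. With all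
  frequencies rounded to a lattice, only a period cell matters, and there it does not.\<close>
definition lattice_pts :: "real \<Rightarrow> (real ^ 'n) set" where
  "lattice_pts h = {y. \<forall>i. \<exists>m::int. y $ i = h * m}"

definition round_to :: "real \<Rightarrow> real ^ 'n \<Rightarrow> real ^ 'n" where
  "round_to h y = (\<chi> i. h * of_int \<lfloor>y $ i / h\<rfloor>)"

lemma round_to_in_lattice: "round_to h y \<in> lattice_pts h"
  by (auto simp: lattice_pts_def round_to_def)

lemma scaled_axis_in_lattice: "(real k * h) *\<^sub>R axis l 1 \<in> lattice_pts h"
  unfolding lattice_pts_def
proof (rule CollectI, rule allI)
  fix i
  show "\<exists>m::int. ((real k * h) *\<^sub>R axis l 1) $ i = h * m"
    by (rule exI[of _ "if i = l then int k else 0"]) (auto simp: axis_def)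
qed

lemma round_to_tendsto:
  fixes y :: "real ^ 'n"
  assumes h: "h \<longlonglongrightarrow> 0" "\<And>N. h N > 0"
  shows "(\<lambda>N. round_to (h N) y) \<longlonglongrightarrow> y"
proof (rule vec_tendstoI)
  fix i
  have "norm (round_to (h N) y $ i - y $ i) \<le> h N" for N
  proof -
    have "round_to (h N) y $ i - y $ i = h N * (of_int \<lfloor>y $ i / h N\<rfloor> - y $ i / h N)"
      using h(2)[of N] by (simp add: round_to_def algebra_simps)
    moreover have "\<bar>of_int \<lfloor>y $ i / h N\<rfloor> - y $ i / h N\<bar> \<le> 1"
      by linarith
    ultimately show ?thesis
      using h(2)[of N] by (simp add: abs_mult)
  qed
  then have "(\<lambda>N. round_to (h N) y $ i - y $ i) \<longlonglongrightarrow> 0"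
    by (intro Lim_null_comparison[OF _ h(1)] always_eventually) auto
  then show "(\<lambda>N. round_to (h N) y $ i) \<longlonglongrightarrow> y $ i"
    by (simp add: LIM_zero_iff)
qed

text \<open>Shifting a coordinate of \<open>u\<close> by a multiple of \<open>2 * pi / h\<close> is
  invisible to lattice frequencies. Here \<open>z i\<close> is the nearest integer to the coordinate
  measured in such periods.\<close>

lemma lattice_fundamental_domain:
  fixes u :: "real ^ 'n"
  assumes h: "h > 0"
  obtains u' where "\<And>i. \<bar>h * u' $ i\<bar> \<le> pi"
    "\<And>y. y \<in> lattice_pts h \<Longrightarrow> cis (y \<bullet> u) = cis (y \<bullet> u')"
proof -
  define z where "z i = \<lfloor>h * u $ i / (2 * pi) + 1 / 2\<rfloor>" for i
  define u' :: "real ^ 'n" where "u' = (\<chi> i. u $ i - 2 * pi / h * z i)"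
  have "\<bar>h * u' $ i\<bar> \<le> pi" for i
  proof -
    have "h * u' $ i = 2 * pi * (h * u $ i / (2 * pi) - z i)"
      using h by (simp add: u'_def field_simps)
    moreover have "\<bar>h * u $ i / (2 * pi) - z i\<bar> \<le> 1 / 2"
      unfolding z_def by linarith
    ultimately show ?thesis
      by (simp add: abs_mult)
  qed
  moreover have "cis (y \<bullet> u) = cis (y \<bullet> u')" if "y \<in> lattice_pts h" for y
  proof -
    obtain m :: "'n \<Rightarrow> int" where m: "\<And>i. y $ i = h * m i"
      using \<open>y \<in> lattice_pts h\<close> unfolding lattice_pts_def by (auto dest!: choice)
    have "y \<bullet> u = y \<bullet> u' + (\<Sum>i\<in>UNIV. 2 * pi * of_int (m i * z i))"
      using h unfolding inner_vec_def sum.distrib[symmetric]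
      by (intro sum.cong) (auto simp: u'_def m field_simps)
    also have "\<dots> = y \<bullet> u' + 2 * pi * of_int (\<Sum>i\<in>UNIV. m i * z i)"
      by (simp add: sum_distrib_left)
    finally show ?thesis
      by (simp only: cis_mult[symmetric] cis_multiple_2pi Ints_of_int mult_1_right)
  qed
  ultimately show ?thesis
    using that by blast
qed

section \<open>Real waves and the inequality fed to the functional\<close>

text \<open>The self-adjoint encoding of the real part of \<open>c\<close> times the exponential of
  frequency \<open>y\<close>. For \<open>y = 0\<close> both terms merge into the constant
  \<open>Re c\<close>.\<close>

definition real_wave :: "complex \<Rightarrow> 'a::group_add \<Rightarrow> 'a \<Rightarrow>\<^sub>0 complex" where
  "real_wave c y = Poly_Mapping.single y (c / 2) + Poly_Mapping.single (- y) (cnj c / 2)"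

lemma self_adjoint_real_wave: "self_adjoint (real_wave c y)"
  by (auto simp: self_adjoint_def real_wave_def lookup_add lookup_single when_def)

lemma trig_real_wave: "Re (trig v (real_wave c y)) = Re (c * cis (y \<bullet> v))"
  by (simp add: trig_def real_wave_def lin_ext_add algebra_simps add_divide_distrib)

lemma lin_ext_real_wave:
  assumes "g (- y) = g y"
  shows "Re (lin_ext g (real_wave c y)) = Re c * Re (g y)"
  using assms by (simp add: real_wave_def lin_ext_add) (simp add: field_simps)

text \<open>Expands a squared exponential sum into waves at the differences
  \<open>y i - y j\<close>, on which the functional reproduces the quadratic form of
  \<open>g\<close>.\<close>

lemma norm_sum_squared:
  "(\<Sum>i\<in>I. \<Sum>j\<in>I. Re (c i * cnj (c j) * cis ((y i - y j) \<bullet> u)))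
     = (norm (\<Sum>i\<in>I. c i * cis (y i \<bullet> u)))\<^sup>2"
proof -
  have "(\<Sum>i\<in>I. c i * cis (y i \<bullet> u)) * cnj (\<Sum>i\<in>I. c i * cis (y i \<bullet> u))
      = (\<Sum>i\<in>I. \<Sum>j\<in>I. c i * cnj (c j) * cis ((y i - y j) \<bullet> u))"
    by (simp add: sum_product cis_cnj inner_diff_left mult_ac)
       (simp add: cis_mult[symmetric] mult_ac flip: add_uminus_conv_diff)
  then have "complex_of_real ((norm (\<Sum>i\<in>I. c i * cis (y i \<bullet> u)))\<^sup>2)
      = (\<Sum>i\<in>I. \<Sum>j\<in>I. c i * cnj (c j) * cis ((y i - y j) \<bullet> u))"
    by (simp only: complex_norm_square)
  then have "Re (complex_of_real ((norm (\<Sum>i\<in>I. c i * cis (y i \<bullet> u)))\<^sup>2))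
      = Re (\<Sum>i\<in>I. \<Sum>j\<in>I. c i * cnj (c j) * cis ((y i - y j) \<bullet> u))"
    by simp
  then show ?thesis
    by (simp only: Re_complex_of_real Re_sum)
qed

lemma one_minus_cos_le: "1 - cos t \<le> t\<^sup>2 / 2" for t :: real
proof -
  have "1 - cos t = 2 * (sin (t / 2))\<^sup>2"
    using cos_double_sin[of "t / 2"] by simp
  also have "\<dots> \<le> 2 * (t / 2)\<^sup>2"
    using abs_sin_x_le_abs_x[of "t / 2"] by (simp add: abs_le_square_iff[symmetric])
  finally show ?thesis
    by (simp add: power2_eq_square)
qed

text \<open>All frequencies lie in the lattice, so \<open>u\<close> may be replaced by a point
  \<open>v\<close> of the period cell. The three terms on the right cover small, intermediate and
  large \<open>norm v\<close> in turn.\<close>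

lemma wave_domination:
  fixes X :: "real ^ 'n" and Y :: "'t \<Rightarrow> 'i \<Rightarrow> real ^ 'n"
  assumes F: "finite F" and \<delta>: "\<delta> \<ge> 0" and \<kappa>: "\<kappa> > 0" and h: "h > 0" and N: "N > 0"
    and K: "real CARD('n) * 12 \<le> real N * h * K"
    and X: "X \<in> lattice_pts h" and Y: "\<And>T i. Y T i \<in> lattice_pts h"
    and lower: "\<And>u. \<delta> \<le> norm u \<Longrightarrow> norm u \<le> K \<Longrightarrow>
       \<exists>T\<in>F. \<kappa> \<le> norm (\<Sum>i\<in>I. c i * cis (Y T i \<bullet> u))"
  shows "1 - cos (X \<bullet> u) \<le> \<delta>\<^sup>2 * (norm X)\<^sup>2 / 2
     + (\<Sum>T\<in>F. 2 / \<kappa>\<^sup>2 * (norm (\<Sum>i\<in>I. c i * cis (Y T i \<bullet> u)))\<^sup>2)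
     + (\<Sum>l\<in>UNIV. \<Sum>k<N. 4 / real N * (1 - cos (((real k * h) *\<^sub>R axis l 1) \<bullet> u)))"
    (is "?L u \<le> ?q + ?W u + ?V u")
proof -
  obtain v where v: "\<And>i. \<bar>h * v $ i\<bar> \<le> pi"
    and cis_eq: "\<And>y. y \<in> lattice_pts h \<Longrightarrow> cis (y \<bullet> u) = cis (y \<bullet> v)"
    using lattice_fundamental_domain[OF h, of u] by blast
  have cos_eq: "cos (y \<bullet> u) = cos (y \<bullet> v)" if "y \<in> lattice_pts h" for y
    using arg_cong[OF cis_eq[OF that], of Re] by simp
  have "?L u = ?L v" "?W u = ?W v" "?V u = ?V v"
    by (simp_all only: cos_eq[OF X] cis_eq[OF Y] cos_eq[OF scaled_axis_in_lattice])
  moreover have q: "0 \<le> ?q" and W: "0 \<le> ?W v" and V: "0 \<le> ?V v"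
    by (auto intro!: sum_nonneg)
  have L: "?L v \<le> 2"
    using cos_ge_minus_one[of "X \<bullet> v"] by linarith
  have "?L v \<le> ?q + ?W v + ?V v"
  proof -
    consider "norm v \<le> \<delta>" | "\<delta> \<le> norm v" "norm v \<le> K" | "K \<le> norm v"
      by linarith
    then show ?thesis
    proof cases
      case 1
      have "?L v \<le> \<bar>X \<bullet> v\<bar>\<^sup>2 / 2"
        using one_minus_cos_le[of "X \<bullet> v"] by simp
      also have "\<bar>X \<bullet> v\<bar>\<^sup>2 \<le> (\<delta> * norm X)\<^sup>2"
      proof (rule power_mono)
        have "\<bar>X \<bullet> v\<bar> \<le> norm X * norm v"
          by (rule Cauchy_Schwarz_ineq2)
        also have "\<dots> \<le> \<delta> * norm X"
          using mult_left_mono[OF 1, of "norm X"] by (simp add: mult.commute)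
        finally show "\<bar>X \<bullet> v\<bar> \<le> \<delta> * norm X" .
      qed simp
      finally show ?thesis
        using W V by (simp add: power_mult_distrib)
    next
      case 2
      then obtain T where T: "T \<in> F" "\<kappa> \<le> norm (\<Sum>i\<in>I. c i * cis (Y T i \<bullet> v))"
        using lower by blast
      \<comment> \<open>The weight \<open>2 / \<kappa>^2\<close> lets one rotated sum alone outweigh
        \<open>1 - cos\<close>, which is at most 2.\<close>
      have "2 = 2 / \<kappa>\<^sup>2 * \<kappa>\<^sup>2"
        using \<kappa> by simp
      also have "\<dots> \<le> 2 / \<kappa>\<^sup>2 * (norm (\<Sum>i\<in>I. c i * cis (Y T i \<bullet> v)))\<^sup>2"
        using T(2) \<kappa> by (intro mult_left_mono power_mono) auto
      also have "\<dots> \<le> ?W v"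
        by (rule member_le_sum) (use F T in auto)
      finally show ?thesis
        using L q V by linarith
    next
      case 3
      \<comment> \<open>The l1 norm dominates the Euclidean norm, so some coordinate carries at
        least the average share of \<open>K\<close>.\<close>
      have "\<exists>l. K \<le> real CARD('n) * \<bar>v $ l\<bar>"
      proof (rule ccontr)
        assume "\<not> ?thesis"
        then have "\<bar>v $ l\<bar> < K / real CARD('n)" for l
          by (simp add: not_le field_simps)
        then have "(\<Sum>l\<in>UNIV. \<bar>v $ l\<bar>) < (\<Sum>l\<in>(UNIV::'n set). K / real CARD('n))"
          by (intro sum_strict_mono) auto
        then show False
          using 3 norm_le_l1_cart[of v] by simp
      qed
      then obtain l where l: "K \<le> real CARD('n) * \<bar>v $ l\<bar>"
        by blast
      have "real CARD('n) * 12 \<le> real N * h * K"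
        by (rule K)
      also have "\<dots> \<le> real N * h * (real CARD('n) * \<bar>v $ l\<bar>)"
        using l h by (intro mult_left_mono) auto
      finally have "real CARD('n) * 12 \<le> real CARD('n) * (real N * \<bar>h * v $ l\<bar>)"
        using h by (simp add: abs_mult mult_ac)
      then have "12 \<le> real N * \<bar>h * v $ l\<bar>"
        by simp
      then have "1 / 2 \<le> (\<Sum>k<N. 1 - cos (real k * (h * v $ l))) / real N"
        by (intro mean_one_minus_cos_ge v)
      \<comment> \<open>The weight 4 turns the mean value 1/2 into the required 2.\<close>
      then have "2 \<le> 4 / real N * (\<Sum>k<N. 1 - cos (real k * (h * v $ l)))"
        by simp
      also have "\<dots> = (\<Sum>k<N. 4 / real N * (1 - cos (((real k * h) *\<^sub>R axis l 1) \<bullet> v)))"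
        by (simp add: sum_distrib_left inner_axis' mult.assoc)
      also have "\<dots> \<le> ?V v"
        by (rule member_le_sum) (auto intro!: sum_nonneg)
      finally show ?thesis
        using L q W by linarith
    qed
  qed
  ultimately show ?thesis
    by simp
qed

text \<open>Right side minus left side of \<open>dom\<close> is a nonnegative trigonometric
  polynomial \<open>P\<close>; the claim is \<open>pd_kernel_nonneg\<close> for \<open>P\<close>,
  evaluated term by term.\<close>

lemma radial_wave_inequality:
  fixes X :: "real ^ 'n" and Y :: "'t \<Rightarrow> 'i \<Rightarrow> real ^ 'n" and \<phi> :: "real \<Rightarrow> real"
  assumes pd: "pd_kernel (\<lambda>y :: real ^ 'n. complex_of_real (\<phi> (norm y)))"
    and B: "\<And>t. t \<ge> 0 \<Longrightarrow> \<bar>\<phi> t\<bar> \<le> B"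
    and dom: "\<And>u. 1 - cos (X \<bullet> u) \<le> q
     + (\<Sum>T\<in>F. C * (norm (\<Sum>i\<in>I. c i * cis (Y T i \<bullet> u)))\<^sup>2)
     + (\<Sum>l\<in>UNIV. \<Sum>k<N. r * (1 - cos (((real k * h) *\<^sub>R axis l 1) \<bullet> u)))"
    and h: "h > 0"
  shows "\<phi> 0 - \<phi> (norm X) \<le> q * \<phi> 0
     + C * (\<Sum>T\<in>F. \<Sum>i\<in>I. \<Sum>j\<in>I. Re (c i * cnj (c j)) * \<phi> (norm (Y T i - Y T j)))
     + (\<Sum>l\<in>(UNIV::'n set). \<Sum>k<N. r * (\<phi> 0 - \<phi> (real k * h)))"
proof -
  let ?g = "\<lambda>y :: real ^ 'n. complex_of_real (\<phi> (norm y))"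
  let ?a = "\<lambda>l k. (real k * h) *\<^sub>R axis l 1 :: real ^ 'n"
  define P where "P = real_wave (of_real q) 0 - real_wave 1 0 + real_wave 1 X
    + (\<Sum>T\<in>F. \<Sum>i\<in>I. \<Sum>j\<in>I. real_wave (of_real C * (c i * cnj (c j))) (Y T i - Y T j))
    + (\<Sum>l\<in>UNIV. \<Sum>k<N. real_wave (of_real r) 0 - real_wave (of_real r) (?a l k))"
  have "0 \<le> Re (lin_ext ?g P)"
  proof (rule pd_kernel_nonneg[OF pd])
    show "norm (?g y) \<le> B" for y
      by (simp add: B)
    show "self_adjoint P"
      unfolding P_def
      by (intro self_adjoint_add self_adjoint_diff self_adjoint_sum self_adjoint_real_wave)
    fix u
    have "Re (trig u P) = q - 1 + cos (X \<bullet> u)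
        + (\<Sum>T\<in>F. \<Sum>i\<in>I. \<Sum>j\<in>I. Re (of_real C * (c i * cnj (c j)) * cis ((Y T i - Y T j) \<bullet> u)))
        + (\<Sum>l\<in>UNIV. \<Sum>k<N. r * (1 - cos (?a l k \<bullet> u)))"
      by (simp only: P_def trig_def lin_ext_add lin_ext_diff lin_ext_sum plus_complex.sel
            minus_complex.sel Re_sum trig_real_wave[unfolded trig_def])
         (simp add: right_diff_distrib)
    also have "(\<Sum>T\<in>F. \<Sum>i\<in>I. \<Sum>j\<in>I. Re (of_real C * (c i * cnj (c j)) * cis ((Y T i - Y T j) \<bullet> u)))
        = (\<Sum>T\<in>F. C * (norm (\<Sum>i\<in>I. c i * cis (Y T i \<bullet> u)))\<^sup>2)"
      unfolding norm_sum_squared[symmetric] sum_distrib_left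
      by (intro sum.cong refl) (simp add: algebra_simps)
    finally show "0 \<le> Re (trig u P)"
      using dom[of u] by simp
  qed
  also have "Re (lin_ext ?g P) = q * \<phi> 0 - \<phi> 0 + \<phi> (norm X)
     + C * (\<Sum>T\<in>F. \<Sum>i\<in>I. \<Sum>j\<in>I. Re (c i * cnj (c j)) * \<phi> (norm (Y T i - Y T j)))
     + (\<Sum>l\<in>(UNIV::'n set). \<Sum>k<N. r * (\<phi> 0 - \<phi> (real k * h)))"
  proof -
    have [simp]: "Re (lin_ext ?g (real_wave z y)) = Re z * \<phi> (norm y)" for z y
      using lin_ext_real_wave[of ?g y z] by simp
    have "norm (?a l k) = real k * h" for l k
      using h by simp
    then show ?thesis
      by (simp add: P_def lin_ext_add lin_ext_diff lin_ext_sum sum_distrib_left right_diff_distrib mult.assoc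
        del: norm_scaleR)
  qed
  finally show ?thesis
    by linarith
qed

section \<open>Refining the lattice and letting the error terms vanish\<close>

text \<open>The rotations and \<open>\<kappa>\<close> are fixed first; then the lattice spacing
  tends to 0. The rounded quadratic forms tend to the original ones, which vanish, so their fixed
  large weight does no harm.\<close>

lemma radial_pd_inequality:
  fixes x :: "'i \<Rightarrow> real ^ 'n" and y :: "real ^ 'n" and \<phi> :: "real \<Rightarrow> real"
  assumes dim: "CARD('n) \<ge> 2"
    and pd: "pd_kernel (\<lambda>y :: real ^ 'n. complex_of_real (\<phi> (norm y)))"
    and B: "\<And>t. t \<ge> 0 \<Longrightarrow> \<bar>\<phi> t\<bar> \<le> B"
    and cont: "continuous_on {0..} \<phi>"
    and I: "finite I" "inj_on x I" "\<exists>i\<in>I. c i \<noteq> 0"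
    and null: "(\<Sum>i\<in>I. \<Sum>j\<in>I. Re (c i * cnj (c j)) * \<phi> (norm (x i - x j))) = 0"
    and \<delta>: "\<delta> > 0" and \<eta>: "\<eta> > 0"
    and \<omega>: "\<And>t. 0 \<le> t \<Longrightarrow> t \<le> \<eta> \<Longrightarrow> \<phi> 0 - \<phi> t \<le> \<omega>"
  shows "\<phi> 0 - \<phi> (norm y) \<le> \<delta>\<^sup>2 * (norm y)\<^sup>2 / 2 * \<phi> 0 + 4 * real CARD('n) * \<omega>"
proof -
  \<comment> \<open>Chosen so that \<open>\<eta> * K\<close> is the threshold of
    \<open>wave_domination\<close>, where \<open>\<eta>\<close> is the number of samples times the
    spacing.\<close>
  define K where "K = 12 * real CARD('n) / \<eta>"
  have K0: "K \<ge> 0"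
    using \<eta> by (simp add: K_def)
  obtain F :: "(real ^ 'n \<Rightarrow> real ^ 'n) set" and \<kappa> where F: "finite F" "\<And>T. T \<in> F \<Longrightarrow> orthogonal_transformation T"
    and \<kappa>: "\<kappa> > 0" and lower: "\<And>u. \<delta> \<le> norm u \<Longrightarrow> norm u \<le> K \<Longrightarrow>
       \<exists>T\<in>F. \<kappa> \<le> norm (\<Sum>i\<in>I. c i * cis (T (x i) \<bullet> u))"
    using finitely_many_rotations[OF dim I \<delta>, of K] by blast
  \<comment> \<open>With \<open>Suc N\<close> samples the sampled radii stay within
    \<open>\<eta>\<close>, where \<open>\<omega>\<close> bounds the drop of
    \<open>\<phi>\<close>.\<close>
  define h where "h N = \<eta> / real (Suc N)" for N
  have h: "h N > 0" for N
    using \<eta> by (simp add: h_def)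
  have h_lim: "h \<longlonglongrightarrow> 0"
    unfolding h_def by real_asymp
  define X where "X N = round_to (h N) y" for N
  define Y where "Y N T i = round_to (h N) (T (x i))" for N and T :: "real ^ 'n \<Rightarrow> real ^ 'n" and i
  have X_lim: "X \<longlonglongrightarrow> y" and Y_lim: "(\<lambda>N. Y N T i) \<longlonglongrightarrow> T (x i)" for T i
    unfolding X_def Y_def using round_to_tendsto[OF h_lim h] by auto
  have \<phi>_lim: "(\<lambda>N. \<phi> (norm (Z N))) \<longlonglongrightarrow> \<phi> (norm z)" if "Z \<longlonglongrightarrow> z" for Z :: "nat \<Rightarrow> real ^ 'n" and z
    by (rule continuous_on_tendsto_compose[OF cont tendsto_norm[OF that]]) auto
  define S where "S N = (\<Sum>T\<in>F. \<Sum>i\<in>I. \<Sum>j\<in>I. Re (c i * cnj (c j)) * \<phi> (norm (Y N T i - Y N T j)))" for N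
  have "S \<longlonglongrightarrow> (\<Sum>T\<in>F. \<Sum>i\<in>I. \<Sum>j\<in>I. Re (c i * cnj (c j)) * \<phi> (norm (T (x i) - T (x j))))"
    unfolding S_def by (intro tendsto_sum tendsto_mult tendsto_const \<phi>_lim tendsto_diff Y_lim)
  also have "(\<Sum>T\<in>F. \<Sum>i\<in>I. \<Sum>j\<in>I. Re (c i * cnj (c j)) * \<phi> (norm (T (x i) - T (x j)))) = 0"
  proof (rule sum.neutral, rule ballI)
    fix T assume "T \<in> F"
    then have T: "orthogonal_transformation T"
      by (rule F(2))
    have "norm (T a - T b) = norm (a - b)" for a b
      using T by (metis linear_diff orthogonal_transformation_linear orthogonal_transformation_norm)
    then show "(\<Sum>i\<in>I. \<Sum>j\<in>I. Re (c i * cnj (c j)) * \<phi> (norm (T (x i) - T (x j)))) = 0"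
      using null by simp
  qed
  finally have S_lim: "S \<longlonglongrightarrow> 0" .
  \<comment> \<open>Bounds the change of the exponential sum under rounding for
    \<open>norm u \<le> K\<close>. Once it is below \<open>\<kappa> / 2\<close>, the lower bound
    survives with half the constant.\<close>
  define E where "E N T = (\<Sum>i\<in>I. norm (c i) * (norm (T (x i) - Y N T i) * K))" for N T
  have "\<forall>\<^sub>F N in sequentially. E N T < \<kappa> / 2" for T
  proof -
    have "(\<lambda>N. E N T) \<longlonglongrightarrow> (\<Sum>i\<in>I. norm (c i) * (norm (T (x i) - T (x i)) * K))"
      unfolding E_def
      by (intro tendsto_sum tendsto_mult tendsto_const tendsto_norm tendsto_diff Y_lim)
    then show ?thesis
      using \<kappa> by (intro order_tendstoD) auto
  qed
  then have ev: "\<forall>\<^sub>F N in sequentially. \<forall>T\<in>F. E N T < \<kappa> / 2"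
    using F(1) by (intro eventually_ball_finite) auto
  define R where "R N = \<delta>\<^sup>2 * (norm (X N))\<^sup>2 / 2 * \<phi> 0 + 2 / (\<kappa> / 2)\<^sup>2 * S N
      + 4 * real CARD('n) * \<omega>" for N
  have "\<phi> 0 - \<phi> (norm (X N)) \<le> R N" if small: "\<forall>T\<in>F. E N T < \<kappa> / 2" for N
  proof -
    have half: "\<exists>T\<in>F. \<kappa> / 2 \<le> norm (\<Sum>i\<in>I. c i * cis (Y N T i \<bullet> u))"
      if u: "\<delta> \<le> norm u" "norm u \<le> K" for u
    proof -
      obtain T where T: "T \<in> F" "\<kappa> \<le> norm (\<Sum>i\<in>I. c i * cis (T (x i) \<bullet> u))"
        using lower[OF u] by blast
      have "norm ((\<Sum>i\<in>I. c i * cis (T (x i) \<bullet> u)) - (\<Sum>i\<in>I. c i * cis (Y N T i \<bullet> u)))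
          = norm (\<Sum>i\<in>I. c i * (cis (T (x i) \<bullet> u) - cis (Y N T i \<bullet> u)))"
        by (simp add: sum_subtractf right_diff_distrib)
      also have "\<dots> \<le> E N T"
        unfolding E_def
      proof (rule sum_norm_le)
        fix i
        have "norm (cis (T (x i) \<bullet> u) - cis (Y N T i \<bullet> u)) \<le> \<bar>(T (x i) - Y N T i) \<bullet> u\<bar>"
          by (metis norm_cis_diff_le inner_diff_left)
        also have "\<dots> \<le> norm (T (x i) - Y N T i) * norm u"
          by (rule Cauchy_Schwarz_ineq2)
        also have "\<dots> \<le> norm (T (x i) - Y N T i) * K"
          using u(2) by (intro mult_left_mono) auto
        finally show "norm (c i * (cis (T (x i) \<bullet> u) - cis (Y N T i \<bullet> u)))
            \<le> norm (c i) * (norm (T (x i) - Y N T i) * K)"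
          unfolding norm_mult by (intro mult_left_mono) auto
      qed
      finally have "norm ((\<Sum>i\<in>I. c i * cis (T (x i) \<bullet> u)) - (\<Sum>i\<in>I. c i * cis (Y N T i \<bullet> u))) < \<kappa> / 2"
        using small T(1) by fastforce
      then have "\<kappa> / 2 \<le> norm (\<Sum>i\<in>I. c i * cis (Y N T i \<bullet> u))"
        using T(2) norm_triangle_ineq2[of "\<Sum>i\<in>I. c i * cis (T (x i) \<bullet> u)" "\<Sum>i\<in>I. c i * cis (Y N T i \<bullet> u)"]
        by linarith
      then show ?thesis
        using T(1) by blast
    qed
    have "\<phi> 0 - \<phi> (norm (X N)) \<le> \<delta>\<^sup>2 * (norm (X N))\<^sup>2 / 2 * \<phi> 0 + 2 / (\<kappa> / 2)\<^sup>2 * S N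
      + (\<Sum>l\<in>(UNIV::'n set). \<Sum>k<Suc N. 4 / real (Suc N) * (\<phi> 0 - \<phi> (real k * h N)))"
      unfolding S_def
    proof (rule radial_wave_inequality[OF pd B _ h], assumption, rule wave_domination[OF F(1) _ _ h _ _ _ _ half])
      show "real CARD('n) * 12 \<le> real (Suc N) * h N * K"
        using \<eta> by (simp add: h_def K_def del: of_nat_Suc)
      show "X N \<in> lattice_pts (h N)" "\<And>T i. Y N T i \<in> lattice_pts (h N)"
        by (simp_all add: X_def Y_def round_to_in_lattice)
    qed (use \<delta> \<kappa> in auto)
    also have "(\<Sum>l\<in>(UNIV::'n set). \<Sum>k<Suc N. 4 / real (Suc N) * (\<phi> 0 - \<phi> (real k * h N)))
        \<le> (\<Sum>l\<in>(UNIV::'n set). \<Sum>k<Suc N. 4 / real (Suc N) * \<omega>)"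
    proof (intro sum_mono mult_left_mono \<omega>)
      fix k assume "k \<in> {..<Suc N}"
      then have "real k * h N \<le> real (Suc N) * h N"
        using h[of N] by (intro mult_right_mono) auto
      then show "real k * h N \<le> \<eta>"
        by (simp add: h_def del: of_nat_Suc)
    qed (use h in \<open>auto simp: less_imp_le\<close>)
    also have "\<dots> = 4 * real CARD('n) * \<omega>"
      by (simp del: of_nat_Suc)
    finally show ?thesis
      by (simp add: R_def)
  qed
  then have le: "\<forall>\<^sub>F N in sequentially. \<phi> 0 - \<phi> (norm (X N)) \<le> R N"
    using ev by (rule eventually_mono[rotated])
  have R_lim: "R \<longlonglongrightarrow> \<delta>\<^sup>2 * (norm y)\<^sup>2 / 2 * \<phi> 0 + 2 / (\<kappa> / 2)\<^sup>2 * 0 + 4 * real CARD('n) * \<omega>"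
    unfolding R_def
    by (intro tendsto_intros X_lim S_lim) simp
  have "(\<lambda>N. \<phi> 0 - \<phi> (norm (X N))) \<longlonglongrightarrow> \<phi> 0 - \<phi> (norm y)"
    by (intro tendsto_diff tendsto_const \<phi>_lim X_lim)
  from tendsto_le[OF _ R_lim this le] show ?thesis
    by simp
qed

lemma radial_pd_null_imp_max:
  fixes x :: "'i \<Rightarrow> real ^ 'n" and y :: "real ^ 'n" and \<phi> :: "real \<Rightarrow> real"
  assumes dim: "CARD('n) \<ge> 2"
    and pd: "pd_kernel (\<lambda>y :: real ^ 'n. complex_of_real (\<phi> (norm y)))"
    and B: "\<And>t. t \<ge> 0 \<Longrightarrow> \<bar>\<phi> t\<bar> \<le> B"
    and cont: "continuous_on {0..} \<phi>"
    and I: "finite I" "inj_on x I" "\<exists>i\<in>I. c i \<noteq> 0"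
    and null: "(\<Sum>i\<in>I. \<Sum>j\<in>I. Re (c i * cnj (c j)) * \<phi> (norm (x i - x j))) = 0"
  shows "\<phi> 0 \<le> \<phi> (norm y)"
proof (rule field_le_epsilon)
  fix \<epsilon> :: real assume "\<epsilon> > 0"
  \<comment> \<open>Chosen so that the second error term equals \<open>\<epsilon>\<close>; the first
    vanishes as \<open>\<delta>\<close> tends to 0.\<close>
  define \<omega> where "\<omega> = \<epsilon> / (4 * real CARD('n))"
  have "\<omega> > 0"
    using \<open>\<epsilon> > 0\<close> by (simp add: \<omega>_def)
  then obtain d where d: "d > 0" "\<And>t. t \<in> {0..} \<Longrightarrow> dist t 0 < d \<Longrightarrow> dist (\<phi> t) (\<phi> 0) < \<omega>"
    using cont[unfolded continuous_on_iff] by (metis atLeast_iff order.refl)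
  have \<omega>: "\<phi> 0 - \<phi> t \<le> \<omega>" if "0 \<le> t" "t \<le> d / 2" for t
    using d(2)[of t] that d(1) by (auto simp: dist_real_def)
  have "\<phi> 0 - \<phi> (norm y) \<le> \<delta>\<^sup>2 * (norm y)\<^sup>2 / 2 * \<phi> 0 + 4 * real CARD('n) * \<omega>" if "\<delta> > 0" for \<delta>
    by (rule radial_pd_inequality[OF dim pd B cont I null that, of "d / 2"]) (use d(1) \<omega> in auto)
  then have "\<forall>\<^sub>F \<delta> in at_right 0. \<phi> 0 - \<phi> (norm y) \<le> \<delta>\<^sup>2 * (norm y)\<^sup>2 / 2 * \<phi> 0 + 4 * real CARD('n) * \<omega>"
    by (simp add: eventually_at_filter)
  moreover have "((\<lambda>\<delta>. \<delta>\<^sup>2 * (norm y)\<^sup>2 / 2 * \<phi> 0 + 4 * real CARD('n) * \<omega>)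
      \<longlongrightarrow> 0\<^sup>2 * (norm y)\<^sup>2 / 2 * \<phi> 0 + 4 * real CARD('n) * \<omega>) (at_right 0)"
    by (intro tendsto_intros) auto
  ultimately have "\<phi> 0 - \<phi> (norm y) \<le> 0\<^sup>2 * (norm y)\<^sup>2 / 2 * \<phi> 0 + 4 * real CARD('n) * \<omega>"
    by (intro tendsto_lowerbound) auto
  then show "\<phi> 0 \<le> \<phi> (norm y) + \<epsilon>"
    by (simp add: \<omega>_def)
qed

section \<open>Strict positive definiteness\<close>

lemma positive_definite_imp_pd_kernel:
  fixes g :: "real ^ 'n \<Rightarrow> complex"
  assumes "positive_definite g"
  shows "pd_kernel g"
  unfolding pd_kernel_def
proof (intro allI impI)
  fix S :: "(real ^ 'n) set" and c assume "finite S"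
  then obtain x where x: "bij_betw x {1..card S} S"
    using ex_bij_betw_nat_finite_1 by blast
  have "0 \<le> (\<Sum>k = 1..card S. \<Sum>j = 1..card S. c (x k) * cnj (c (x j)) * g (x k - x j))"
    using assms unfolding positive_definite_def by (elim conjE allE)
  also have "\<dots> = (\<Sum>k = 1..card S. \<Sum>z\<in>S. c (x k) * cnj (c z) * g (x k - z))"
    by (intro sum.cong refl sum.reindex_bij_betw[OF x])
  also have "\<dots> = (\<Sum>y\<in>S. \<Sum>z\<in>S. c y * cnj (c z) * g (y - z))"
    by (rule sum.reindex_bij_betw[OF x])
  finally show "0 \<le> Re (\<Sum>y\<in>S. \<Sum>z\<in>S. c y * cnj (c z) * g (y - z))"
    by (simp add: less_eq_complex_def)
qed

text \<open>The points \<open>z\<close> and 0 with weights 1 and \<open>s\<close>, for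
  \<open>s\<close> equal to 1 and -1: comparing imaginary parts gives reality, and the real part for
  -1 gives the bound.\<close>

lemma positive_definite_two_points:
  assumes pd: "positive_definite g" and even: "g (- z) = g z"
  shows "Im (g z) = 0" "Re (g z) \<le> Re (g 0)"
proof -
  have two: "0 \<le> 2 * g 0 + 2 * of_real s * g z" if "s\<^sup>2 = 1" for s
  proof -
    define \<xi> where "\<xi> k = (if k = 1 then 1 else complex_of_real s)" for k :: nat
    define x where "x k = (if k = 1 then z else 0)" for k :: nat
    have "0 \<le> (\<Sum>k = 1..2. \<Sum>j = 1..2. \<xi> k * cnj (\<xi> j) * g (x k - x j))"
      using pd unfolding positive_definite_def by blast
    also have "\<dots> = 2 * g 0 + 2 * of_real s * g z"
      using that even
      by (simp add: \<xi>_def x_def numeral_2_eq_2 power2_eq_square algebra_simps flip: of_real_mult)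
    finally show ?thesis .
  qed
  show "Im (g z) = 0" "Re (g z) \<le> Re (g 0)"
    using two[of 1] two[of "-1"] by (auto simp: less_eq_complex_def)
qed

theorem theorem3p6:
  fixes f :: "real \<Rightarrow> complex"
  assumes "CARD('n::finite) \<ge> 2"
    and "f \<in> radial_positive_definite TYPE('n)"
    and "\<not> f constant_on {0..}"
  shows "strictly_positive_definite (\<lambda>x :: real ^ 'n. f (norm x))"
proof -
  let ?g = "\<lambda>x :: real ^ 'n. f (norm x)"
  define \<phi> where "\<phi> t = Re (f t)" for t
  have cont: "continuous_on {0..} f" and bdd: "bounded (f ` {0..})" and pd: "positive_definite ?g"
    using assms(2) by (auto simp: radial_positive_definite_def)
  have ex_vec: "\<exists>z :: real ^ 'n. norm z = t" if "t \<ge> 0" for t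
    using vector_choose_size[OF that] by blast
  have f_eq: "f t = complex_of_real (\<phi> t)" and f_le: "\<phi> t \<le> \<phi> 0" if t: "t \<ge> 0" for t
  proof -
    obtain z :: "real ^ 'n" where "norm z = t"
      using ex_vec[OF t] by blast
    then show "f t = complex_of_real (\<phi> t)" "\<phi> t \<le> \<phi> 0"
      using positive_definite_two_points[OF pd, of z] by (auto simp: \<phi>_def complex_eq_iff)
  qed
  have pd_ker: "pd_kernel (\<lambda>y :: real ^ 'n. complex_of_real (\<phi> (norm y)))"
    using positive_definite_imp_pd_kernel[OF pd] by (simp add: f_eq)
  obtain B where B: "\<And>t. t \<ge> 0 \<Longrightarrow> norm (f t) \<le> B"
    using bdd by (auto simp: bounded_iff)
  have B': "\<bar>\<phi> t\<bar> \<le> B" if "t \<ge> 0" for t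
    using B[OF that] f_eq[OF that] by simp
  have cont': "continuous_on {0..} \<phi>"
    unfolding \<phi>_def by (intro continuous_intros cont)
  show ?thesis
    unfolding strictly_positive_definite_def
  proof (intro conjI allI impI pd)
    fix m :: nat and x :: "nat \<Rightarrow> real ^ 'n" and \<xi> :: "nat \<Rightarrow> complex"
    let ?S = "\<Sum>k = 1..m. \<Sum>j = 1..m. \<xi> k * cnj (\<xi> j) * f (norm (x k - x j))"
    assume inj: "inj_on x {1..m}" and pos: "(\<Sum>k = 1..m. cmod (\<xi> k)) > 0"
    have nz: "\<exists>k\<in>{1..m}. \<xi> k \<noteq> 0"
      using pos by (metis (no_types, lifting) less_irrefl norm_zero sum.neutral)
    \<comment> \<open>The form is already nonnegative, so only its vanishing must be excluded: it
      would make every value of \<open>\<phi>\<close> on the half-line equal to the maximum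
      \<open>\<phi> 0\<close>.\<close>
    have "?S \<noteq> 0"
    proof
      assume "?S = 0"
      then have "Re ?S = 0"
        by simp
      then have null: "(\<Sum>k = 1..m. \<Sum>j = 1..m. Re (\<xi> k * cnj (\<xi> j)) * \<phi> (norm (x k - x j))) = 0"
        by (simp add: f_eq)
      have "f constant_on {0..}"
        unfolding constant_on_def
      proof (intro exI ballI)
        fix t :: real assume "t \<in> {0..}"
        then obtain z :: "real ^ 'n" where z: "norm z = t" "t \<ge> 0"
          using ex_vec by auto
        have "\<phi> 0 \<le> \<phi> t"
          using radial_pd_null_imp_max[OF assms(1) pd_ker B' cont' _ inj nz null, of z] z by simp
        then show "f t = f 0"
          using f_le[of t] z by (simp add: f_eq)
      qed
      then show False
        using assms(3) by simp
    qed
    moreover have "0 \<le> ?S"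
      using pd unfolding positive_definite_def by blast
    ultimately show "0 < ?S"
      by simp
  qed
qed

end
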